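(* The Heat--Airy polynomials $\mathcal H_n(x,t,s)=P_{t,s}(x^n)$, $n\ge0$, satisfy $$\sum_{n=0}^{\infty}\frac{\mathcal H_n(x,t,s)}{n!}z^n=\exp\left(xz+\frac t2z^2-\frac s3z^3\right)$$ as formal power series in $z$.
   Context: $D=\frac{d}{dx}$, and $P_{t,s}=\exp\left(\frac t2D^2-\frac s3D^3\right)$, acting on polynomials in $x$ by its exponential series (a finite sum on each polynomial), $t,s\geq 0$. *)

theory Defs
  imports
    "HOL-Computational_Algebra.Computational_Algebra"
    "HOL-Library.Groups_Big_Fun"
begin

definition heat_airy_gen :: "real \<Rightarrow> real \<Rightarrow> real poly \<Rightarrow> real poly" where
  "heat_airy_gen t s p = smult (t / 2) ((pderiv ^^ 2) p) - smult (s / 3) ((pderiv ^^ 3) p)"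

text \<open>
  The exponential series of an operator on polynomials. The constant \<^const>\<open>Sum_any\<close> sums over
  the set of indices with nonzero summand and is a junk value if that set is infinite;
  \<open>finite_heat_airy_support\<close> below shows that this does not happen here.
\<close>

definition op_exp :: "(real poly \<Rightarrow> real poly) \<Rightarrow> real poly \<Rightarrow> real poly" where
  "op_exp A p = Sum_any (\<lambda>k. smult (1 / fact k) ((A ^^ k) p))"

definition heat_airy_op :: "real \<Rightarrow> real \<Rightarrow> real poly \<Rightarrow> real poly" where
  "heat_airy_op t s = op_exp (heat_airy_gen t s)"

definition heat_airy_poly :: "nat \<Rightarrow> real \<Rightarrow> real \<Rightarrow> real poly" where
  "heat_airy_poly n t s = heat_airy_op t s (monom 1 n)"

lemma coeff_heat_airy_gen_funpow_eq_0:
  "degree p < i + k \<Longrightarrow> coeff ((heat_airy_gen t s ^^ k) p) i = 0"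
proof (induction k arbitrary: i)
  case 0
  then show ?case by (simp add: coeff_eq_0)
next
  case (Suc k)
  then show ?case
    by (simp add: heat_airy_gen_def numeral_2_eq_2 numeral_3_eq_3 coeff_pderiv)
qed

lemma finite_heat_airy_support:
  "finite {k. smult (1 / fact k) ((heat_airy_gen t s ^^ k) p) \<noteq> 0}"
proof (rule finite_subset)
  show "{k. smult (1 / fact k) ((heat_airy_gen t s ^^ k) p) \<noteq> 0} \<subseteq> {..degree p}"
  proof
    fix k
    assume "k \<in> {k. smult (1 / fact k) ((heat_airy_gen t s ^^ k) p) \<noteq> 0}"
    then have "(heat_airy_gen t s ^^ k) p \<noteq> 0" by auto
    then obtain i where "coeff ((heat_airy_gen t s ^^ k) p) i \<noteq> 0"
      by (auto simp: poly_eq_iff)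
    then have "\<not> degree p < i + k"
      using coeff_heat_airy_gen_funpow_eq_0 by blast
    then show "k \<in> {..degree p}" by simp
  qed
qed simp

end

theory Submission
  imports Defs
begin

text \<open>
  Let \<open>g(z) = t z\<^sup>2 / 2 - s z\<^sup>3 / 3\<close> be the symbol of the generator. Its action on \<open>x\<^sup>n / n!\<close>
  lowers \<open>n\<close>, so on exponential generating functions it is multiplication by \<open>g(z)\<close>: the \<open>k\<close>-th
  power of the generator turns \<open>exp (x z)\<close> into \<open>g(z)\<^sup>k exp (x z)\<close>. Summing over \<open>k\<close> with
  weights \<open>1 / k!\<close> gives \<open>exp (g(z)) exp (x z)\<close>.
\<close>

text \<open>Comparing coefficients at \<open>m\<close> determines \<open>Suc m\<close> times the
  next coefficient from the earlier ones; characteristic 0 allows cancelling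
  \<open>Suc m\<close>.\<close>

lemma fps_linear_ODE_unique:
  fixes u v w :: "'a :: field_char_0 fps"
  assumes "fps_deriv u = w * u" and "fps_deriv v = w * v" and "u $ 0 = v $ 0"
  shows "u = v"
proof -
  have "u $ n = v $ n" for n
  proof (induction n rule: less_induct)
    case (less n)
    show ?case
    proof (cases n)
      case 0
      then show ?thesis using assms(3) by simp
    next
      case (Suc m)
      have "of_nat (Suc m) * u $ Suc m = (w * u) $ m"
        by (simp flip: assms(1))
      also have "\<dots> = (w * v) $ m"
        using less.IH Suc by (simp add: fps_mult_nth)
      also have "\<dots> = of_nat (Suc m) * v $ Suc m"
        by (simp flip: assms(2))
      finally have "of_nat (Suc m) * u $ Suc m = of_nat (Suc m) * v $ Suc m" .
      then show ?thesis unfolding Suc mult_cancel_left by (metis of_nat_neq_0)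
    qed
  qed
  then show ?thesis by (simp add: fps_eq_iff)
qed

text \<open>By the chain rule both sides solve y' = (a' + b') y, and both have constant term
  1.\<close>

lemma fps_exp_compose_add:
  fixes a b :: "'a :: field_char_0 fps"
  assumes "a $ 0 = 0" and "b $ 0 = 0"
  shows "fps_exp 1 oo (a + b) = (fps_exp 1 oo a) * (fps_exp 1 oo b)"
proof (rule fps_linear_ODE_unique[where w = "fps_deriv a + fps_deriv b"])
  show "fps_deriv (fps_exp 1 oo (a + b)) = (fps_deriv a + fps_deriv b) * (fps_exp 1 oo (a + b))"
    using assms by (simp add: fps_compose_deriv mult.commute)
  show "fps_deriv ((fps_exp 1 oo a) * (fps_exp 1 oo b)) =
      (fps_deriv a + fps_deriv b) * ((fps_exp 1 oo a) * (fps_exp 1 oo b))"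
    using assms by (simp add: fps_compose_deriv algebra_simps)
qed simp

text \<open>Since \<open>b ^ k\<close> has no terms below degree \<open>k\<close>, only
  \<open>k \<le> n\<close> contribute. This is the same truncation as for the operator exponential
  on a polynomial of degree \<open>n\<close>.\<close>

lemma fps_compose_mult_nth:
  fixes a b c :: "'a :: comm_ring_1 fps"
  assumes "b $ 0 = 0"
  shows "((a oo b) * c) $ n = (\<Sum>k\<le>n. a $ k * (b ^ k * c) $ n)"
proof -
  \<comment> \<open>Padding with zero terms makes the range of \<open>k\<close> independent of
    \<open>i\<close>, so the double sum can be swapped.\<close>
  have "(a oo b) $ i = (\<Sum>k\<le>n. a $ k * b ^ k $ i)" if "i \<le> n" for i
    unfolding fps_compose_nth
    using that startsby_zero_power_prefix[OF assms] by (intro sum.mono_neutral_left) auto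
  then have "((a oo b) * c) $ n = (\<Sum>i\<le>n. \<Sum>k\<le>n. a $ k * b ^ k $ i * c $ (n - i))"
    by (simp add: fps_mult_nth atLeast0AtMost sum_distrib_right)
  also have "\<dots> = (\<Sum>k\<le>n. \<Sum>i\<le>n. a $ k * b ^ k $ i * c $ (n - i))"
    by (rule sum.swap)
  finally show ?thesis
    by (simp add: fps_mult_nth atLeast0AtMost sum_distrib_left mult.assoc)
qed

lemma heat_airy_gen_funpow_diff:
  "(heat_airy_gen t s ^^ k) (p - q) = (heat_airy_gen t s ^^ k) p - (heat_airy_gen t s ^^ k) q"
  by (induction k)
    (simp_all add: heat_airy_gen_def numeral_2_eq_2 numeral_3_eq_3 pderiv_diff smult_diff_right)

lemma heat_airy_gen_funpow_smult:
  "(heat_airy_gen t s ^^ k) (smult c p) = smult c ((heat_airy_gen t s ^^ k) p)"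
  by (induction k)
    (simp_all add: heat_airy_gen_def numeral_2_eq_2 numeral_3_eq_3 pderiv_smult smult_diff_right
      mult.commute)

text \<open>Dividing by \<open>fact n\<close> absorbs the factors from differentiation, leaving a
  pure index shift. The case split matches the coefficients of a product with
  \<open>fps_X ^ j\<close>.\<close>

lemma pderiv_funpow_monom_div_fact:
  "smult (1 / fact n) ((pderiv ^^ j) (monom 1 n)) =
    (if n < j then 0 else smult (1 / fact (n - j)) (monom (1 :: real) (n - j)))"
proof (induction j)
  case (Suc j)
  have "smult (1 / fact n) ((pderiv ^^ Suc j) (monom 1 n)) =
      pderiv (smult (1 / fact n) ((pderiv ^^ j) (monom (1 :: real) n)))"
    by (simp add: pderiv_smult)
  also have "\<dots> = (if n < Suc j then 0 else smult (1 / fact (n - Suc j)) (monom 1 (n - Suc j)))"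
  proof (cases "n \<le> j")
    case True
    then show ?thesis by (auto simp: Suc.IH pderiv_smult pderiv_monom)
  next
    case False
    then have "n - j = Suc (n - Suc j)" by simp
    then show ?thesis using False
      by (simp add: Suc.IH pderiv_smult pderiv_monom smult_monom field_simps del: of_nat_Suc)
  qed
  finally show ?case .
qed simp

lemma egf_heat_airy_gen_funpow:
  "Abs_fps (\<lambda>n. poly ((heat_airy_gen t s ^^ k) (monom 1 n)) x / fact n) =
    (fps_const (t / 2) * fps_X ^ 2 - fps_const (s / 3) * fps_X ^ 3) ^ k * fps_exp x"
proof (induction k)
  case 0
  show ?case by (simp add: fps_eq_iff poly_monom)
next
  case (Suc k)
  let ?A = "heat_airy_gen t s"
  let ?F = "Abs_fps (\<lambda>n. poly ((?A ^^ k) (monom 1 n)) x / fact n)"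
  let ?g = "fps_const (t / 2) * fps_X ^ 2 - fps_const (s / 3) * fps_X ^ 3"
  have shift: "poly ((?A ^^ k) (smult (1 / fact n) ((pderiv ^^ j) (monom 1 n)))) x =
      (fps_X ^ j * ?F) $ n" for n j
    \<comment> \<open>The instance with scalar 0 says that powers of the generator send 0 to 0,
      which settles \<open>n < j\<close>.\<close>
    by (simp add: pderiv_funpow_monom_div_fact heat_airy_gen_funpow_smult fps_X_power_mult_nth
        heat_airy_gen_funpow_smult[of k t s 0 0, simplified])
  have "poly ((?A ^^ Suc k) (monom 1 n)) x / fact n = (?g * ?F) $ n" for n
  proof -
    \<comment> \<open>The additional factor \<open>?A\<close> is moved innermost, where it acts on a
      monomial and \<open>shift\<close> applies.\<close>
    have "poly ((?A ^^ Suc k) (monom 1 n)) x / fact n =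
        poly ((?A ^^ k) (smult (1 / fact n) (?A (monom 1 n)))) x"
      by (simp add: heat_airy_gen_funpow_smult funpow_swap1)
    also have "smult (1 / fact n) (?A (monom 1 n)) =
        smult (t / 2) (smult (1 / fact n) ((pderiv ^^ 2) (monom 1 n))) -
        smult (s / 3) (smult (1 / fact n) ((pderiv ^^ 3) (monom 1 n)))"
      by (simp add: heat_airy_gen_def smult_diff_right mult.commute)
    also have "poly ((?A ^^ k) \<dots>) x =
        t / 2 * (fps_X ^ 2 * ?F) $ n - s / 3 * (fps_X ^ 3 * ?F) $ n"
      by (simp only: heat_airy_gen_funpow_diff heat_airy_gen_funpow_smult[of k t s "t / 2"]
          heat_airy_gen_funpow_smult[of k t s "s / 3"] poly_diff poly_smult shift)
    also have "\<dots> = (?g * ?F) $ n"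
      by (simp only: left_diff_distrib mult.assoc fps_sub_nth fps_mult_left_const_nth)
    finally show ?thesis .
  qed
  then have "Abs_fps (\<lambda>n. poly ((?A ^^ Suc k) (monom 1 n)) x / fact n) = ?g * ?F"
    by (simp only: fps_eq_iff fps_nth_Abs_fps) simp
  then show ?case
    by (simp only: Suc.IH power_Suc mult.assoc)
qed

text \<open>The generator lowers degrees, so its \<open>k\<close>-th power kills \<open>p\<close>
  once \<open>k\<close> exceeds \<open>degree p\<close>.\<close>

lemma op_exp_heat_airy_gen:
  "op_exp (heat_airy_gen t s) p =
    (\<Sum>k\<le>degree p. smult (1 / fact k) ((heat_airy_gen t s ^^ k) p))"
  unfolding op_exp_def
proof (rule Sum_any.expand_superset)
  have "(heat_airy_gen t s ^^ k) p = 0" if "degree p < k" for k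
    using that by (simp add: poly_eq_iff coeff_heat_airy_gen_funpow_eq_0)
  then show "{k. smult (1 / fact k) ((heat_airy_gen t s ^^ k) p) \<noteq> 0} \<subseteq> {..degree p}"
    by (auto simp flip: not_less)
qed simp

theorem theorem3p3:
  fixes x t s :: real
  assumes "t \<ge> 0" and "s \<ge> 0"
  shows "Abs_fps (\<lambda>n. poly (heat_airy_poly n t s) x / fact n) =
    fps_exp 1 oo (fps_const x * fps_X + fps_const (t / 2) * fps_X ^ 2 - fps_const (s / 3) * fps_X ^ 3)"
proof -
  define g where "g = fps_const (t / 2) * fps_X ^ 2 - fps_const (s / 3) * fps_X ^ 3"
  have g0: "g $ 0 = 0" by (simp add: g_def)
  have "poly (heat_airy_poly n t s) x / fact n = ((fps_exp 1 oo g) * fps_exp x) $ n" for n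
  proof -
    have "poly (heat_airy_poly n t s) x / fact n =
        (\<Sum>k\<le>n. 1 / fact k * (poly ((heat_airy_gen t s ^^ k) (monom 1 n)) x / fact n))"
      by (simp add: heat_airy_poly_def heat_airy_op_def op_exp_heat_airy_gen degree_monom_eq
          poly_sum sum_divide_distrib)
    \<comment> \<open>The weight \<open>1 / fact k\<close> is the \<open>k\<close>-th coefficient of
      \<open>fps_exp 1\<close>; the other factor is the \<open>n\<close>-th coefficient of the
      generating function for the \<open>k\<close>-th power.\<close>
    also have "\<dots> = (\<Sum>k\<le>n. fps_exp 1 $ k * (g ^ k * fps_exp x) $ n)"
      by (simp add: g_def flip: egf_heat_airy_gen_funpow)
    finally show ?thesis
      by (simp only: fps_compose_mult_nth[OF g0])
  qed
  then have "Abs_fps (\<lambda>n. poly (heat_airy_poly n t s) x / fact n) = (fps_exp 1 oo g) * fps_exp x"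
    by (simp add: fps_eq_iff)
  also have "\<dots> = fps_exp 1 oo (fps_const x * fps_X + g)"
    \<comment> \<open>Here \<open>fps_exp x\<close> is read as \<open>fps_exp 1\<close> composed
      with \<open>fps_const x * fps_X\<close>, so the two exponents add.\<close>
    using g0 fps_exp_compose_linear[of 1 x] by (simp add: fps_exp_compose_add mult.commute[of "fps_exp x"])
  finally show ?thesis
    by (simp add: g_def add_diff_eq)
qed

end
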